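(* Let $h\in\mathbb{F}[x]$ with $\deg h\ge1$ and $\mathcal{A}=\mathrm{Aut}_{\mathbb{F}}(A_h)$. The center of $\mathcal{A}$ is $Z(\mathcal{A})=\{\phi_r: r\in D_Z\}$, where $D_Z=\{r\in\mathbb{F}[x]: r(\zeta x+\varepsilon)=\zeta^{\deg h-1}r(x)\ \forall(\zeta,\varepsilon)\in\mathbb{P}\}$, and: (1) if $\mathcal{A}=\{\phi_f:f\in\mathbb{F}[x]\}$, then $D_Z=\mathbb{F}[x]$ and $Z(\mathcal{A})=\mathcal{A}$; (2) if $\tau_{\mathbb{P}}=\tau_{1,\mathbb{G}}$, then $D_Z=\mathbb{F}[t]$ with $t(x)=\prod_{\nu\in\mathbb{G}}(x+\nu)$; (3) if $\tau_{\mathbb{P}}\cong\mathbb{F}^*$ as in the case $h=\gamma(x-\lambda)^n$ with $\gamma\in\mathbb{F}^*$, $\lambda\in\mathbb{F}$, $n\ge1$, and $\mathbb{F}$ is infinite, then $D_Z=\mathbb{F}(x-\lambda)^{n-1}$; (4) if $\tau_{\mathbb{P}}=\tau_{1,\mathbb{G}}\rtimes\langle\tau_{\alpha,\beta}\rangle$ with $\alpha$ a primitive $\ell$-th root of unity for some $\ell>1$, then $D_Z=q\,\mathbb{F}[t]$ where $q(x)=\prod_{\nu\in\mathbb{G}}\left(x+\frac{\beta}{\alpha-1}+\nu\right)^{n}$, $t(x)=\prod_{\nu\in\mathbb{G}}\left(x+\frac{\beta}{\alpha-1}+\nu\right)^{\ell}$, and $0\le n<\ell$ is the integer with $n|\mathbb{G}|\equiv\deg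 h-1\pmod{\ell}$. In all cases $\{\phi_r: r\in\mathbb{F}h'\}\subseteq Z(\mathcal{A})$.
   Context: $\mathbb{F}$ is an arbitrary field. For $h\in\mathbb{F}[x]$, $A_h$ is the unital associative $\mathbb{F}$-algebra generated by $x,\hat y$ with defining relation $\hat yx-x\hat y=h$. Let $\mathbb{P}=\{(\alpha,\beta)\in\mathbb{F}^*\times\mathbb{F}: h(\alpha x+\beta)=\alpha^{\deg h}h(x)\}$; for $(\alpha,\beta)\in\mathbb{P}$, $\tau_{\alpha,\beta}$ is the automorphism of $A_h$ with $x\mapsto\alpha x+\beta$, $\hat y\mapsto\alpha^{\deg h-1}\hat y$; $\tau_{\mathbb{P}}=\{\tau_{\alpha,\beta}\}$. For $f\in\mathbb{F}[x]$, $\phi_f$ is the automorphism with $x\mapsto x$, $\hat y\mapsto\hat y+f$. It is known that $\mathcal{A}=\{\phi_f\}\rtimes\tau_{\mathbb{P}}$. $\mathbb{G}=\{\nu\in\mathbb{F}:(1,\nu)\in\mathbb{P}\}$ (finite additive subgroup) and $\tau_{1,\mathbb{G}}=\{\tau_{1,\nu}:\nu\in\mathbb{G}\}$. $h'$ is the formal derivative. *)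

theory Defs
  imports "HOL-Computational_Algebra.Polynomial"
begin

text \<open>Concrete model of A_h = F<x, y> / (y x - x y = h): the Ore extension F[x][y; D]
  with D = h * d/dx. An element is represented in its PBW normal form
  sum_i a_i(x) y^i, i.e. as an element of type 'a poly poly (outer variable y,
  coefficients in F[x]). Multiplication:
  (a y^i)(b y^j) = sum_{k<=i} (i choose k) a D^k(b) y^(i+j-k).\<close>

definition Dh :: "'a::field poly \<Rightarrow> 'a poly \<Rightarrow> 'a poly" where
  "Dh h a = h * pderiv a"

definition ahmult :: "'a::field poly \<Rightarrow> 'a poly poly \<Rightarrow> 'a poly poly \<Rightarrow> 'a poly poly" where
  "ahmult h P Q = (\<Sum>i\<le>degree P. \<Sum>j\<le>degree Q. \<Sum>k\<le>i.
      monom (of_nat (i choose k) * coeff P i * (Dh h ^^ k) (coeff Q j)) (i + j - k))"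

fun ahpow :: "'a::field poly \<Rightarrow> 'a poly poly \<Rightarrow> nat \<Rightarrow> 'a poly poly" where
  "ahpow h P 0 = 1"
| "ahpow h P (Suc n) = ahmult h P (ahpow h P n)"

text \<open>The generators: x = [:[:0,1:]:], y = [:0,1:].\<close>

definition is_aut :: "'a::field poly \<Rightarrow> ('a poly poly \<Rightarrow> 'a poly poly) \<Rightarrow> bool" where
  "is_aut h \<sigma> \<longleftrightarrow> bij \<sigma>
     \<and> (\<forall>P Q. \<sigma> (P + Q) = \<sigma> P + \<sigma> Q)
     \<and> (\<forall>c P. \<sigma> (smult [:c:] P) = smult [:c:] (\<sigma> P))
     \<and> (\<forall>P Q. \<sigma> (ahmult h P Q) = ahmult h (\<sigma> P) (\<sigma> Q))
     \<and> \<sigma> 1 = 1"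

definition Aut :: "'a::field poly \<Rightarrow> ('a poly poly \<Rightarrow> 'a poly poly) set" where
  "Aut h = {\<sigma>. is_aut h \<sigma>}"

definition AutCenter :: "'a::field poly \<Rightarrow> ('a poly poly \<Rightarrow> 'a poly poly) set" where
  "AutCenter h = {\<sigma> \<in> Aut h. \<forall>\<tau> \<in> Aut h. \<sigma> \<circ> \<tau> = \<tau> \<circ> \<sigma>}"

text \<open>The algebra map determined by x \<mapsto> u (an element of F[x]) and y \<mapsto> Y:
  sum_i a_i(x) y^i \<mapsto> sum_i a_i(u) Y^i.\<close>

definition subst_map :: "'a::field poly \<Rightarrow> 'a poly \<Rightarrow> 'a poly poly \<Rightarrow> 'a poly poly \<Rightarrow> 'a poly poly" where
  "subst_map h u Y P = (\<Sum>i\<le>degree P. ahmult h [:pcompose (coeff P i) u:] (ahpow h Y i))"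

definition phi :: "'a::field poly \<Rightarrow> 'a poly \<Rightarrow> 'a poly poly \<Rightarrow> 'a poly poly" where
  "phi h f = subst_map h [:0, 1:] [:f, 1:]"

definition tau :: "'a::field poly \<Rightarrow> 'a \<Rightarrow> 'a \<Rightarrow> 'a poly poly \<Rightarrow> 'a poly poly" where
  "tau h \<alpha> \<beta> = subst_map h [:\<beta>, \<alpha>:] [:0, [:\<alpha> ^ (degree h - 1):]:]"

definition PP :: "'a::field poly \<Rightarrow> ('a \<times> 'a) set" where
  "PP h = {(\<alpha>, \<beta>). \<alpha> \<noteq> 0 \<and> pcompose h [:\<beta>, \<alpha>:] = smult (\<alpha> ^ degree h) h}"

definition tauP :: "'a::field poly \<Rightarrow> ('a poly poly \<Rightarrow> 'a poly poly) set" where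
  "tauP h = (\<lambda>(\<alpha>, \<beta>). tau h \<alpha> \<beta>) ` PP h"

definition GG :: "'a::field poly \<Rightarrow> 'a set" where
  "GG h = {\<nu>. (1, \<nu>) \<in> PP h}"

definition DZ :: "'a::field poly \<Rightarrow> 'a poly set" where
  "DZ h = {r. \<forall>(\<zeta>, \<epsilon>) \<in> PP h. pcompose r [:\<epsilon>, \<zeta>:] = smult (\<zeta> ^ (degree h - 1)) r}"

definition prim_root :: "'a::field \<Rightarrow> nat \<Rightarrow> bool" where
  "prim_root \<alpha> l \<longleftrightarrow> \<alpha> ^ l = 1 \<and> (\<forall>k. 0 < k \<and> k < l \<longrightarrow> \<alpha> ^ k \<noteq> 1)"

end

theory Submission
  imports Defs
begin

text \<open>
  Modulo \<open>h\<close> the algebra \<open>A\<^sub>h\<close> is commutative and \<open>h = yx - xy\<close>, so the ideal generated by the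
  commutators is \<open>hA\<^sub>h\<close>, where \<open>h\<close> is a normal element. The units of \<open>A\<^sub>h\<close> are the constants
  because the degree in \<open>y\<close> is additive; hence an automorphism \<open>\<sigma>\<close> maps \<open>h\<close> to a multiple \<open>ch\<close>.
  Comparing degrees in \<open>h(\<sigma>(x)) = ch\<close> shows \<open>\<sigma>(x) = \<alpha>x + \<beta>\<close> with \<open>(\<alpha>, \<beta>)\<close> in \<open>PP h\<close>;
  surjectivity forces \<open>\<sigma>(y)\<close> to have degree 1 in \<open>y\<close>, and \<open>[\<sigma>(y), \<sigma>(x)] = \<sigma>(h)\<close> fixes its
  leading coefficient \<open>\<alpha>\<^bsup>deg h - 1\<^esup>\<close>. Commuting with \<open>\<phi>\<^sub>1\<close> and \<open>\<phi>\<^sub>x\<close> forces \<open>\<alpha> = 1\<close>, \<open>\<beta> = 0\<close>, and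
  commuting with the \<open>\<tau>\<^bsub>\<zeta>,\<epsilon>\<^esub>\<close> is the condition defining \<open>D\<^sub>Z\<close>. The rest is invariant theory of affine
  substitutions in one variable.
\<close>

section \<open>The algebra structure\<close>

text \<open>Left multiplication by \<open>y\<close> in normal form, from
  \<open>y a = a y + Dh h a\<close>. Its iterates turn the triple sum in \<open>ahmult\<close> into
  a recursion on the left factor.\<close>

definition ymul :: "'a::field poly \<Rightarrow> 'a poly poly \<Rightarrow> 'a poly poly" where
  "ymul h Q = map_poly (Dh h) Q + pCons 0 Q"

lemma Dh_0 [simp]: "Dh h 0 = 0"
  by (simp add: Dh_def)

lemma Dh_add: "Dh h (a + b) = Dh h a + Dh h b"
  by (simp add: Dh_def pderiv_add algebra_simps)

lemma Dh_mult: "Dh h (a * b) = a * Dh h b + Dh h a * b"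
  by (simp add: Dh_def pderiv_mult algebra_simps)

lemma Dh_1 [simp]: "Dh h 1 = 0"
  by (simp add: Dh_def)

lemma coeff_ymul:
  "coeff (ymul h Q) n = Dh h (coeff Q n) + (case n of 0 \<Rightarrow> 0 | Suc m \<Rightarrow> coeff Q m)"
  by (simp add: ymul_def coeff_map_poly coeff_pCons)

lemma ymul_0 [simp]: "ymul h 0 = 0"
  by (simp add: ymul_def)

lemma ymul_add: "ymul h (P + Q) = ymul h P + ymul h Q"
  by (rule poly_eqI) (simp add: coeff_ymul Dh_add split: nat.split)

lemma ymul_sum: "ymul h (sum f A) = (\<Sum>i\<in>A. ymul h (f i))"
  by (induction A rule: infinite_finite_induct) (simp_all add: ymul_add)

lemma ymul_smult: "ymul h (smult a Q) = smult (Dh h a) Q + smult a (ymul h Q)"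
  by (rule poly_eqI) (simp add: coeff_ymul Dh_mult algebra_simps split: nat.split)

lemma ymul_of_nat: "ymul h (of_nat n * Q) = of_nat n * ymul h Q"
  by (induction n) (simp_all add: ymul_add algebra_simps)

lemma ymul_monom: "ymul h (monom b j) = monom (Dh h b) j + monom b (Suc j)"
  by (simp add: ymul_def map_poly_monom monom_Suc)

lemma ymul_pCons: "ymul h (pCons a P) = pCons (Dh h a) ([:a:] + ymul h P)"
  by (simp add: ymul_def map_poly_pCons)

lemma ymul_funpow_add: "(ymul h ^^ i) (P + Q) = (ymul h ^^ i) P + (ymul h ^^ i) Q"
  by (induction i) (simp_all add: ymul_add)

lemma ymul_funpow_0 [simp]: "(ymul h ^^ i) 0 = 0"
  by (induction i) simp_all

lemma ymul_funpow_sum: "(ymul h ^^ i) (sum f A) = (\<Sum>j\<in>A. (ymul h ^^ i) (f j))"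
  by (induction A rule: infinite_finite_induct) (simp_all add: ymul_funpow_add)

lemma binomial_sum_shift:
  fixes g :: "nat \<Rightarrow> 'b::comm_semiring_1"
  shows "(\<Sum>k\<le>n. of_nat (n choose k) * (g (Suc k) + g k)) = (\<Sum>k\<le>Suc n. of_nat (Suc n choose k) * g k)"
proof -
  have a: "(\<Sum>k\<le>n. of_nat (n choose k) * g k) = g 0 + (\<Sum>k\<le>n. of_nat (n choose Suc k) * g (Suc k))"
  proof -
    have "(\<Sum>k\<le>n. of_nat (n choose k) * g k) = (\<Sum>k\<le>Suc n. of_nat (n choose k) * g k)"
      by (simp add: binomial_eq_0)
    also have "\<dots> = g 0 + (\<Sum>k\<le>n. of_nat (n choose Suc k) * g (Suc k))"
      by (subst sum.atMost_Suc_shift) simp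
    finally show ?thesis .
  qed
  have "(\<Sum>k\<le>Suc n. of_nat (Suc n choose k) * g k)
      = g 0 + (\<Sum>k\<le>n. of_nat (Suc n choose Suc k) * g (Suc k))"
    by (subst sum.atMost_Suc_shift) simp
  also have "\<dots> = (\<Sum>k\<le>n. of_nat (n choose k) * g (Suc k)) + (\<Sum>k\<le>n. of_nat (n choose k) * g k)"
    by (simp add: a distrib_right sum.distrib add_ac)
  finally show ?thesis
    by (simp add: distrib_left sum.distrib)
qed

lemma monom_of_nat_mult: "monom (of_nat c * b) m = of_nat c * monom b m"
  by (induction c) (simp_all add: distrib_right flip: add_monom)

text \<open>Induction on \<open>i\<close>: one more \<open>y\<close> either differentiates the
  coefficient or raises the exponent, and Pascal's rule collects the two contributions. The result
  is the inner sum in \<open>ahmult\<close>.\<close>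

lemma ymul_funpow_monom:
  "(ymul h ^^ i) (monom b j) =
     (\<Sum>k\<le>i. monom (of_nat (i choose k) * (Dh h ^^ k) b) (i + j - k))"
proof (induction i)
  case 0
  then show ?case by simp
next
  case (Suc i)
  \<comment> \<open>The exponent is that of the target sum: up to its binomial coefficient,
    \<open>ymul\<close> sends the old \<open>k\<close>-th term to
    \<open>g (Suc k) + g k\<close>.\<close>
  define g where "g k = monom ((Dh h ^^ k) b) (Suc i + j - k)" for k
  have "(ymul h ^^ Suc i) (monom b j)
      = (\<Sum>k\<le>i. of_nat (i choose k) * ymul h (monom ((Dh h ^^ k) b) (i + j - k)))"
    using Suc by (simp add: ymul_sum monom_of_nat_mult ymul_of_nat)
  also have "\<dots> = (\<Sum>k\<le>i. of_nat (i choose k) * (g (Suc k) + g k))"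
    by (intro sum.cong refl) (simp add: ymul_monom g_def Suc_diff_le)
  also have "\<dots> = (\<Sum>k\<le>Suc i. of_nat (Suc i choose k) * g k)"
    by (rule binomial_sum_shift)
  finally show ?case
    by (simp only: g_def monom_of_nat_mult)
qed

lemma smult_sum_right: "smult a (sum f A) = (\<Sum>i\<in>A. smult a (f i))"
  by (induction A rule: infinite_finite_induct) (simp_all add: smult_add_right)

lemma ahmult_eq_sum_ymul:
  "ahmult h P Q = (\<Sum>i\<le>degree P. smult (coeff P i) ((ymul h ^^ i) Q))"
proof -
  have "(ymul h ^^ i) Q = (\<Sum>j\<le>degree Q. \<Sum>k\<le>i.
      monom (of_nat (i choose k) * (Dh h ^^ k) (coeff Q j)) (i + j - k))" for i
    by (subst poly_as_sum_of_monoms[of Q, symmetric])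
       (simp add: ymul_funpow_sum ymul_funpow_monom)
  then show ?thesis
    by (simp add: ahmult_def smult_sum_right smult_monom mult_ac)
qed

section \<open>Ring laws of \<open>ahmult\<close>\<close>

lemma ahmult_0_left [simp]: "ahmult h 0 Q = 0"
  by (simp add: ahmult_eq_sum_ymul)

text \<open>Coefficients stand to the left of powers of \<open>y\<close>, so
  \<open>pCons a P\<close> is \<open>a + P y\<close>, and the \<open>y\<close> is absorbed by the
  right factor.\<close>

lemma ahmult_pCons_left: "ahmult h (pCons a P) Q = smult a Q + ahmult h P (ymul h Q)"
proof (cases "P = 0")
  case True
  then show ?thesis
    by (simp add: ahmult_eq_sum_ymul)
next
  case False
  then show ?thesis
    by (simp add: ahmult_eq_sum_ymul sum.atMost_Suc_shift funpow_swap1 del: sum.atMost_Suc)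
qed

lemma ahmult_const_left [simp]: "ahmult h [:a:] Q = smult a Q"
  by (simp add: ahmult_pCons_left)

lemma ahmult_1_left [simp]: "ahmult h 1 Q = Q"
  using ahmult_const_left[of h 1 Q] by (simp flip: one_pCons)

lemma ahmult_add_right: "ahmult h P (Q + R) = ahmult h P Q + ahmult h P R"
  by (induction P arbitrary: Q R) (simp_all add: ahmult_pCons_left ymul_add smult_add_right)

lemma ahmult_0_right [simp]: "ahmult h P 0 = 0"
  by (induction P) (simp_all add: ahmult_pCons_left)

lemma ahmult_add_left: "ahmult h (P + Q) R = ahmult h P R + ahmult h Q R"
proof (induction P arbitrary: Q R)
  case (pCons a P)
  obtain b Q' where "Q = pCons b Q'"
    by (cases Q)
  then show ?case
    by (simp add: ahmult_pCons_left pCons.IH smult_add_left)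
qed simp

lemma ahmult_smult_left: "ahmult h (smult a P) Q = smult a (ahmult h P Q)"
  by (induction P arbitrary: Q) (simp_all add: ahmult_pCons_left smult_add_right)

text \<open>Associativity with left factor \<open>y\<close>; peeling off one \<open>y\<close> at a
  time reduces the general law to this case.\<close>

lemma ymul_ahmult: "ymul h (ahmult h P Q) = ahmult h (ymul h P) Q"
  by (induction P arbitrary: Q)
     (simp_all add: ahmult_pCons_left ymul_pCons ymul_add ymul_smult ahmult_add_left)

lemma ahmult_assoc: "ahmult h P (ahmult h Q R) = ahmult h (ahmult h P Q) R"
  by (induction P arbitrary: Q)
     (simp_all add: ahmult_pCons_left ahmult_add_left ahmult_smult_left ymul_ahmult)

text \<open>\<open>Dh h\<close> kills \<open>1\<close>, so a power of \<open>y\<close> on the right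
  only shifts.\<close>

lemma ahmult_monom_right: "ahmult h P (monom 1 k) = P * monom 1 k"
proof (induction P arbitrary: k)
  case (pCons a P)
  then show ?case
    using pCons.IH[of "Suc k"] by (simp add: ahmult_pCons_left ymul_monom) (simp add: monom_Suc)
qed simp

lemma ahmult_1_right [simp]: "ahmult h P 1 = P"
  using ahmult_monom_right[of h P 0] by simp

lemma ahmult_y_right: "ahmult h P [:0, 1:] = pCons 0 P"
  using ahmult_monom_right[of h P 1] by (simp add: monom_Suc flip: one_pCons)

lemma ahmult_y_left: "ahmult h [:0, 1:] Q = ymul h Q"
  by (simp add: ahmult_pCons_left)

section \<open>Additivity of the degree in \<open>y\<close>\<close>

lemma degree_lead_coeff_ymul:
  assumes "Q \<noteq> 0"
  shows "degree (ymul h Q) = Suc (degree Q) \<and> lead_coeff (ymul h Q) = lead_coeff Q"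
proof -
  have c: "coeff (ymul h Q) (Suc (degree Q)) = lead_coeff Q"
    by (simp add: coeff_ymul coeff_eq_0)
  have "degree (ymul h Q) \<le> Suc (degree Q)"
    by (rule degree_le) (auto simp: coeff_ymul coeff_eq_0 split: nat.split)
  moreover have "Suc (degree Q) \<le> degree (ymul h Q)"
    by (rule le_degree) (use assms c in simp)
  ultimately show ?thesis
    using c by simp
qed

lemma ymul_funpow_degree:
  assumes "Q \<noteq> 0"
  shows "(ymul h ^^ i) Q \<noteq> 0 \<and> degree ((ymul h ^^ i) Q) = i + degree Q
    \<and> lead_coeff ((ymul h ^^ i) Q) = lead_coeff Q"
proof (induction i)
  case (Suc i)
  then show ?case
    using degree_lead_coeff_ymul[of "(ymul h ^^ i) Q" h] by (auto simp flip: leading_coeff_0_iff)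
qed (use assms in simp)

text \<open>Only the leading term of \<open>P\<close> reaches the exponent
  \<open>degree P + degree Q\<close>, where it contributes the product of the leading coefficients,
  nonzero in the domain of polynomials in \<open>x\<close>.\<close>

lemma degree_ahmult:
  assumes "P \<noteq> 0" "Q \<noteq> 0"
  shows "ahmult h P Q \<noteq> 0" "degree (ahmult h P Q) = degree P + degree Q"
proof -
  have "coeff (ahmult h P Q) (degree P + degree Q)
      = (\<Sum>i\<le>degree P. coeff P i * coeff ((ymul h ^^ i) Q) (degree P + degree Q))"
    by (simp add: ahmult_eq_sum_ymul coeff_sum)
  also have "\<dots> = (\<Sum>i\<in>{degree P}. coeff P i * coeff ((ymul h ^^ i) Q) (degree P + degree Q))"
    using ymul_funpow_degree[OF assms(2), where h = h]
    by (intro sum.mono_neutral_right) (auto simp: coeff_eq_0)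
  also have "\<dots> = lead_coeff P * lead_coeff Q"
    using ymul_funpow_degree[OF assms(2), where h = h and i = "degree P"] by auto
  finally have c: "coeff (ahmult h P Q) (degree P + degree Q) \<noteq> 0"
    using assms by simp
  then show "ahmult h P Q \<noteq> 0"
    by auto
  have "degree (ahmult h P Q) \<le> degree P + degree Q"
    unfolding ahmult_eq_sum_ymul
    using ymul_funpow_degree[OF assms(2), where h = h]
    by (intro degree_sum_le) (auto intro: order.trans[OF degree_smult_le])
  with c show "degree (ahmult h P Q) = degree P + degree Q"
    by (meson le_antisym le_degree)
qed

text \<open>Each application of \<open>Dh h\<close> brings in a factor \<open>h\<close>; what
  remains is the commutative product \<open>P * Q\<close> of polynomials.\<close>

lemma ahmult_mod_h: "\<exists>W. ahmult h P Q = P * Q + smult h W"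
proof (induction P arbitrary: Q)
  case 0
  then show ?case by (intro exI[of _ 0]) simp
next
  case (pCons a P)
  have "map_poly (Dh h) Q = smult h (map_poly pderiv Q)"
    by (rule poly_eqI) (simp add: coeff_map_poly Dh_def)
  moreover obtain W where "ahmult h P (ymul h Q) = P * ymul h Q + smult h W"
    using pCons by blast
  ultimately have "ahmult h (pCons a P) Q = pCons a P * Q + smult h (P * map_poly pderiv Q + W)"
    by (simp add: ahmult_pCons_left ymul_def algebra_simps smult_add_right)
  then show ?case by blast
qed

lemma commutator_dvd: "\<exists>W. ahmult h P Q - ahmult h Q P = smult h W"
proof -
  obtain V W where "ahmult h P Q = P * Q + smult h V" "ahmult h Q P = Q * P + smult h W"
    using ahmult_mod_h by metis
  then have "ahmult h P Q - ahmult h Q P = smult h (V - W)"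
    by (simp add: smult_diff_right algebra_simps)
  then show ?thesis ..
qed

section \<open>Homomorphisms\<close>

definition alg_hom :: "'a::field poly \<Rightarrow> ('a poly poly \<Rightarrow> 'a poly poly) \<Rightarrow> bool" where
  "alg_hom h \<sigma> \<longleftrightarrow> (\<forall>P Q. \<sigma> (P + Q) = \<sigma> P + \<sigma> Q)
     \<and> (\<forall>c P. \<sigma> (smult [:c:] P) = smult [:c:] (\<sigma> P))
     \<and> (\<forall>P Q. \<sigma> (ahmult h P Q) = ahmult h (\<sigma> P) (\<sigma> Q))
     \<and> \<sigma> 1 = 1"

abbreviation gen_x :: "'a::field poly poly" where "gen_x \<equiv> [:[:0, 1:]:]"

abbreviation gen_y :: "'a::field poly poly" where "gen_y \<equiv> [:0, 1:]"

lemma is_aut_iff: "is_aut h \<sigma> \<longleftrightarrow> bij \<sigma> \<and> alg_hom h \<sigma>"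
  by (simp add: is_aut_def alg_hom_def)

lemma alg_homD:
  assumes "alg_hom h \<sigma>"
  shows "\<sigma> (P + Q) = \<sigma> P + \<sigma> Q" "\<sigma> (smult [:c:] P) = smult [:c:] (\<sigma> P)"
    "\<sigma> (ahmult h P Q) = ahmult h (\<sigma> P) (\<sigma> Q)" "\<sigma> 1 = 1"
  using assms by (simp_all add: alg_hom_def)

lemma alg_hom_0:
  assumes "alg_hom h \<sigma>"
  shows "\<sigma> 0 = 0"
  using alg_homD(2)[OF assms, of 0 0] by simp

lemma alg_hom_diff:
  assumes "alg_hom h \<sigma>"
  shows "\<sigma> (P - Q) = \<sigma> P - \<sigma> Q"
  using alg_homD(1)[OF assms, of "P - Q" Q] by simp

lemma alg_hom_comp: "alg_hom h \<sigma> \<Longrightarrow> alg_hom h \<tau> \<Longrightarrow> alg_hom h (\<sigma> \<circ> \<tau>)"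
  by (simp add: alg_hom_def)

lemma alg_hom_id: "alg_hom h id"
  by (simp add: alg_hom_def)

lemma alg_hom_inv:
  assumes "bij \<sigma>" "alg_hom h \<sigma>"
  shows "alg_hom h (inv \<sigma>)"
proof -
  have inj: "inj \<sigma>" and r: "\<sigma> (inv \<sigma> P) = P" for P
    using assms(1) by (simp_all add: bij_is_inj bij_is_surj surj_f_inv_f)
  show ?thesis
    unfolding alg_hom_def
    by (intro conjI allI; rule injD[OF inj]) (simp_all add: r alg_homD[OF assms(2)])
qed

lemma alg_hom_const:
  assumes "alg_hom h \<sigma>"
  shows "\<sigma> [:[:c:]:] = [:[:c:]:]"
  using alg_homD(2)[OF assms, of c 1] by (simp add: alg_homD(4)[OF assms])

lemma alg_hom_pCons_const:
  assumes "alg_hom h \<sigma>"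
  shows "\<sigma> [:pCons c a:] = [:[:c:]:] + ahmult h (\<sigma> gen_x) (\<sigma> [:a:])"
proof -
  have "\<sigma> [:pCons c a:] = \<sigma> ([:[:c:]:] + ahmult h gen_x [:a:])"
    by simp
  also have "\<dots> = [:[:c:]:] + ahmult h (\<sigma> gen_x) (\<sigma> [:a:])"
    by (simp only: alg_homD[OF assms] alg_hom_const[OF assms])
  finally show ?thesis .
qed

lemma alg_hom_pCons:
  assumes "alg_hom h \<sigma>"
  shows "\<sigma> (pCons a P) = \<sigma> [:a:] + ahmult h (\<sigma> P) (\<sigma> gen_y)"
proof -
  have "\<sigma> (pCons a P) = \<sigma> ([:a:] + ahmult h P gen_y)"
    by (simp add: ahmult_y_right)
  also have "\<dots> = \<sigma> [:a:] + ahmult h (\<sigma> P) (\<sigma> gen_y)"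
    by (simp only: alg_homD[OF assms])
  finally show ?thesis .
qed

lemma alg_hom_ext:
  assumes "alg_hom h \<sigma>" "alg_hom h \<tau>" "\<sigma> gen_x = \<tau> gen_x" "\<sigma> gen_y = \<tau> gen_y"
  shows "\<sigma> = \<tau>"
proof
  have const: "\<sigma> [:a:] = \<tau> [:a:]" for a
  proof (induction a)
    case (pCons c a)
    then show ?case
      by (simp only: alg_hom_pCons_const[OF assms(1), of c a] alg_hom_pCons_const[OF assms(2), of c a] assms(3))
  qed (simp add: alg_hom_0[OF assms(1)] alg_hom_0[OF assms(2)])
  show "\<sigma> P = \<tau> P" for P
  proof (induction P)
    case (pCons a P)
    then show ?case
      by (simp only: alg_hom_pCons[OF assms(1), of a P] alg_hom_pCons[OF assms(2), of a P] const assms(4))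
  qed (simp add: alg_hom_0[OF assms(1)] alg_hom_0[OF assms(2)])
qed

lemma alg_hom_pcompose:
  assumes "alg_hom h \<sigma>" "\<sigma> gen_x = [:u:]"
  shows "\<sigma> [:a:] = [:pcompose a u:]"
proof (induction a)
  case (pCons c a)
  then show ?case
    by (simp add: alg_hom_pCons_const[OF assms(1), of c a] assms(2) pcompose_pCons)
qed (simp add: alg_hom_0[OF assms(1)])

section \<open>Substitution maps\<close>

lemma ahmult_sum_left: "ahmult h (sum f A) Q = (\<Sum>i\<in>A. ahmult h (f i) Q)"
  by (induction A rule: infinite_finite_induct) (simp_all add: ahmult_add_left)

text \<open>\<open>ahpow\<close> adds new factors on the left, whereas the Horner recursion for
  \<open>subst_map\<close> peels off \<open>Y\<close> on the right.\<close>

lemma ahpow_Suc_right: "ahpow h Y (Suc n) = ahmult h (ahpow h Y n) Y"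
  by (induction n) (simp_all add: ahmult_assoc)

lemma subst_map_0 [simp]: "subst_map h u Y 0 = 0"
  by (simp add: subst_map_def)

lemma subst_map_pCons:
  "subst_map h u Y (pCons a P) = [:pcompose a u:] + ahmult h (subst_map h u Y P) Y"
proof (cases "P = 0")
  case True
  then show ?thesis
    by (simp add: subst_map_def)
next
  case False
  then show ?thesis
    by (simp add: subst_map_def sum.atMost_Suc_shift ahmult_sum_left ahpow_Suc_right
        ahmult_smult_left del: sum.atMost_Suc ahpow.simps(2))
qed

lemma subst_map_add: "subst_map h u Y (P + Q) = subst_map h u Y P + subst_map h u Y Q"
proof (induction P arbitrary: Q)
  case (pCons a P)
  obtain b Q' where "Q = pCons b Q'"
    by (cases Q)
  then show ?case
    by (simp add: subst_map_pCons pCons.IH pcompose_add ahmult_add_left)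
qed simp

lemma subst_map_smult: "subst_map h u Y (smult a P) = smult (pcompose a u) (subst_map h u Y P)"
  by (induction P)
     (simp_all add: subst_map_pCons pcompose_mult ahmult_smult_left smult_add_right)

text \<open>The assumption is the image of the relation \<open>y b = b y + Dh h b\<close>. It makes
  left multiplication by \<open>Y\<close> correspond to \<open>ymul\<close>, and multiplicativity
  follows by recursion on the left factor.\<close>

lemma alg_hom_subst_map:
  assumes comm: "\<And>b. ahmult h Y [:pcompose b u:] = smult (pcompose b u) Y + [:pcompose (Dh h b) u:]"
  shows "alg_hom h (subst_map h u Y)"
proof -
  define S where "S = subst_map h u Y"
  note S_simps = subst_map_add[of h u Y, folded S_def] subst_map_smult[of h u Y, folded S_def]
    subst_map_pCons[of h u Y, folded S_def] subst_map_0[of h u Y, folded S_def]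
  have S_ymul: "S (ymul h P) = ahmult h Y (S P)" for P
    by (induction P)
       (simp_all add: ymul_pCons S_simps comm ahmult_add_left ahmult_add_right ahmult_assoc)
  have "S (ahmult h P Q) = ahmult h (S P) (S Q)" for P Q
    by (induction P arbitrary: Q)
       (simp_all add: ahmult_pCons_left S_simps S_ymul ahmult_add_left ahmult_assoc)
  moreover have "S 1 = 1"
    by (simp add: one_pCons S_simps)
  ultimately show ?thesis
    by (simp add: alg_hom_def S_simps flip: S_def)
qed

text \<open>The summand \<open>f\<close> commutes with polynomials in \<open>x\<close>, so
  \<open>y + f\<close> satisfies the same commutation relation as \<open>y\<close>.\<close>

lemma alg_hom_phi: "alg_hom h (phi h f)"
  unfolding phi_def
  by (rule alg_hom_subst_map) (simp add: ahmult_pCons_left ymul_pCons)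

lemma phi_gen_x: "phi h f gen_x = gen_x"
  by (simp add: phi_def subst_map_pCons)

lemma phi_gen_y: "phi h f gen_y = [:f, 1:]"
  by (simp add: phi_def subst_map_pCons pcompose_1)

lemma phi_const: "phi h f [:a:] = [:a:]"
  using alg_hom_pcompose[OF alg_hom_phi phi_gen_x] by simp

lemma aut_if_inverse:
  assumes "alg_hom h \<sigma>" "alg_hom h \<tau>"
    and "\<sigma> (\<tau> gen_x) = gen_x" "\<sigma> (\<tau> gen_y) = gen_y"
    and "\<tau> (\<sigma> gen_x) = gen_x" "\<tau> (\<sigma> gen_y) = gen_y"
  shows "\<sigma> \<in> Aut h"
proof -
  have "\<sigma> \<circ> \<tau> = id" "\<tau> \<circ> \<sigma> = id"
    by (rule alg_hom_ext[of h]; use assms in \<open>simp add: alg_hom_comp alg_hom_id\<close>)+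
  then show ?thesis
    using assms(1) o_bij by (auto simp: Aut_def is_aut_iff)
qed

lemma phi_linear: "phi h f [:a, b:] = [:a, 0:] + smult b [:f, 1:]"
  using alg_hom_pCons[OF alg_hom_phi, of h f a "[:b:]"] by (simp add: phi_const phi_gen_y)

lemma phi_in_Aut: "phi h f \<in> Aut h"
  by (rule aut_if_inverse[OF alg_hom_phi alg_hom_phi[of h "- f"]])
     (simp_all add: phi_const phi_gen_y phi_linear)

text \<open>The chain rule contributes one factor \<open>\<alpha>\<close>; together with
  \<open>\<alpha> ^ (degree h - 1)\<close> from the image of \<open>y\<close> it matches
  \<open>\<alpha> ^ degree h\<close> from membership in \<open>PP h\<close>.\<close>

lemma alg_hom_tau:
  assumes "(\<alpha>, \<beta>) \<in> PP h" "degree h \<ge> 1"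
  shows "alg_hom h (tau h \<alpha> \<beta>)"
  unfolding tau_def
proof (rule alg_hom_subst_map)
  fix b
  \<comment> \<open>Natural subtraction truncates at \<open>0\<close>, hence the appeal to
    \<open>degree h \<ge> 1\<close>.\<close>
  have "\<alpha> ^ (degree h - 1) * \<alpha> = \<alpha> ^ degree h"
    using assms(2) by (cases "degree h") simp_all
  then have "smult (\<alpha> ^ (degree h - 1)) (Dh h (pcompose b [:\<beta>, \<alpha>:])) = pcompose (Dh h b) [:\<beta>, \<alpha>:]"
    using assms(1) by (simp add: PP_def Dh_def pderiv_pcompose pcompose_mult pderiv_pCons mult_ac)
  then show "ahmult h [:0, [:\<alpha> ^ (degree h - 1):]:] [:pcompose b [:\<beta>, \<alpha>:]:] =
      smult (pcompose b [:\<beta>, \<alpha>:]) [:0, [:\<alpha> ^ (degree h - 1):]:] + [:pcompose (Dh h b) [:\<beta>, \<alpha>:]:]"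
    by (simp add: ahmult_pCons_left ymul_pCons mult.commute)
qed

lemma tau_gen_x: "tau h \<alpha> \<beta> gen_x = [:[:\<beta>, \<alpha>:]:]"
  by (simp add: tau_def subst_map_pCons pcompose_pCons)

lemma tau_gen_y: "tau h \<alpha> \<beta> gen_y = [:0, [:\<alpha> ^ (degree h - 1):]:]"
  by (simp add: tau_def subst_map_pCons pcompose_1)

lemma tau_const:
  assumes "(\<alpha>, \<beta>) \<in> PP h" "degree h \<ge> 1"
  shows "tau h \<alpha> \<beta> [:a:] = [:pcompose a [:\<beta>, \<alpha>:]:]"
  using alg_hom_pcompose[OF alg_hom_tau[OF assms] tau_gen_x] .

lemma PP_inverse:
  assumes "(\<alpha>, \<beta>) \<in> PP h"
  shows "(1 / \<alpha>, - (\<beta> / \<alpha>)) \<in> PP h"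
proof -
  have a: "\<alpha> \<noteq> 0" and e: "pcompose h [:\<beta>, \<alpha>:] = smult (\<alpha> ^ degree h) h"
    using assms by (auto simp: PP_def)
  have "pcompose (pcompose h [:\<beta>, \<alpha>:]) [:- (\<beta> / \<alpha>), 1 / \<alpha>:] = h"
    using a by (simp add: pcompose_pCons flip: pcompose_assoc)
  then have "smult (\<alpha> ^ degree h) (pcompose h [:- (\<beta> / \<alpha>), 1 / \<alpha>:]) = h"
    by (simp add: e pcompose_smult)
  then have "smult (1 / \<alpha> ^ degree h) (smult (\<alpha> ^ degree h) (pcompose h [:- (\<beta> / \<alpha>), 1 / \<alpha>:]))
      = smult (1 / \<alpha> ^ degree h) h"
    by simp
  then show ?thesis
    using a by (simp add: PP_def power_one_over)
qed

lemma tau_in_Aut: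
  assumes "(\<alpha>, \<beta>) \<in> PP h" "degree h \<ge> 1"
  shows "tau h \<alpha> \<beta> \<in> Aut h"
proof -
  note inv = PP_inverse[OF assms(1)]
  have a: "\<alpha> \<noteq> 0"
    using assms by (auto simp: PP_def)
  have y: "tau h \<alpha> \<beta> [:0, [:c:]:] = [:0, [:c * \<alpha> ^ (degree h - 1):]:]"
    if "(\<alpha>, \<beta>) \<in> PP h" for \<alpha> \<beta> c
    using alg_hom_pCons[OF alg_hom_tau[OF that assms(2)], of 0 "[:[:c:]:]"] that assms(2)
    by (simp add: tau_const tau_gen_y alg_hom_0[OF alg_hom_tau[OF that assms(2)]] mult.commute)
  have gen_y: "gen_y = [:0, [:1 :: 'a:]:]"
    by (simp flip: one_pCons)
  \<comment> \<open>The last two conditions say that the affine maps are mutually inverse; stating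
    this for arbitrary pairs serves both orders of composition.\<close>
  have inverse: "tau h \<alpha> \<beta> (tau h \<gamma> \<delta> gen_x) = gen_x \<and> tau h \<alpha> \<beta> (tau h \<gamma> \<delta> gen_y) = gen_y"
    if "(\<alpha>, \<beta>) \<in> PP h" "(\<gamma>, \<delta>) \<in> PP h" "\<gamma> * \<alpha> = 1" "\<delta> + \<gamma> * \<beta> = 0" for \<alpha> \<beta> \<gamma> \<delta>
  proof
    show "tau h \<alpha> \<beta> (tau h \<gamma> \<delta> gen_x) = gen_x"
      using that assms(2) by (simp add: tau_gen_x tau_const pcompose_pCons mult.commute)
    have "\<gamma> ^ (degree h - 1) * \<alpha> ^ (degree h - 1) = 1"
      using that(3) by (metis power_mult_distrib power_one)
    then show "tau h \<alpha> \<beta> (tau h \<gamma> \<delta> gen_y) = gen_y"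
      unfolding gen_y using that by (simp only: y mult_1_left)
  qed
  show ?thesis
    using aut_if_inverse[OF alg_hom_tau[OF assms] alg_hom_tau[OF inv assms(2)]]
      inverse[OF assms(1) inv] inverse[OF inv assms(1)] a by simp
qed

section \<open>Classification of the automorphisms and their center\<close>

lemma smult_left_cancel:
  fixes a :: "'b::idom"
  assumes "a \<noteq> 0"
  shows "smult a p = smult a q \<longleftrightarrow> p = q"
proof -
  have "smult a p = smult a q \<longleftrightarrow> smult a (p - q) = 0"
    by (simp add: smult_diff_right)
  then show ?thesis
    using assms by simp
qed

text \<open>A summand free of \<open>y\<close> cannot cancel the leading term of a product with a
  factor \<open>Y\<close> of positive degree. The first version fits Horner's scheme in
  \<open>x\<close>, the second that in \<open>y\<close>.\<close>

lemma degree_const_add_ahmult: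
  assumes "degree Y > 0" "Q \<noteq> 0" "degree C = 0"
  shows "C + ahmult h Y Q \<noteq> 0 \<and> degree (C + ahmult h Y Q) = degree Y + degree Q"
    and "C + ahmult h Q Y \<noteq> 0 \<and> degree (C + ahmult h Q Y) = degree Y + degree Q"
proof -
  have Y: "Y \<noteq> 0"
    using assms(1) by auto
  have add: "C + R \<noteq> 0 \<and> degree (C + R) = degree Y + degree Q"
    if "degree R = degree Y + degree Q" for R
  proof -
    have "degree C < degree R"
      using that assms by simp
    then have "degree (C + R) = degree R"
      by (rule degree_add_eq_right)
    then show ?thesis
      using that assms(1) by auto
  qed
  show "C + ahmult h Y Q \<noteq> 0 \<and> degree (C + ahmult h Y Q) = degree Y + degree Q"
    by (rule add) (simp add: degree_ahmult[OF Y assms(2)])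
  show "C + ahmult h Q Y \<noteq> 0 \<and> degree (C + ahmult h Q Y) = degree Y + degree Q"
    by (rule add) (simp add: degree_ahmult[OF assms(2) Y])
qed

text \<open>Each Horner step multiplies by the image of \<open>x\<close> once more, and degrees add.
  With \<open>a = h\<close> this excludes automorphisms whose image of \<open>x\<close> involves
  \<open>y\<close>.\<close>

lemma alg_hom_degree_const:
  assumes "alg_hom h \<sigma>" "degree (\<sigma> gen_x) > 0" "a \<noteq> 0"
  shows "\<sigma> [:a:] \<noteq> 0 \<and> degree (\<sigma> [:a:]) = degree a * degree (\<sigma> gen_x)"
  using assms(3)
proof (induction a)
  case (pCons c a)
  show ?case
  proof (cases "a = 0")
    case True
    then show ?thesis
      using pCons by (simp add: alg_hom_const[OF assms(1)])
  next
    case False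
    then show ?thesis
      using pCons degree_const_add_ahmult(1)[OF assms(2), of "\<sigma> [:a:]" "[:[:c:]:]" h]
      by (simp add: alg_hom_pCons_const[OF assms(1), of c a])
  qed
qed simp

text \<open>The same count for Horner's scheme in \<open>y\<close>; injectivity keeps the image of
  the leading coefficient from vanishing.\<close>

lemma alg_hom_degree:
  assumes "alg_hom h \<sigma>" "inj \<sigma>" "\<And>a. degree (\<sigma> [:a:]) = 0" "degree (\<sigma> gen_y) > 0" "P \<noteq> 0"
  shows "\<sigma> P \<noteq> 0 \<and> degree (\<sigma> P) = degree P * degree (\<sigma> gen_y)"
  using assms(5)
proof (induction P)
  case (pCons a P)
  show ?case
  proof (cases "P = 0")
    case True
    then show ?thesis
      using pCons assms(3)[of a] injD[OF assms(2), of "[:a:]" 0] alg_hom_0[OF assms(1)] by auto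
  next
    case False
    then show ?thesis
      using pCons degree_const_add_ahmult(2)[OF assms(4), of "\<sigma> P" "\<sigma> [:a:]" h] assms(3)
      by (simp add: alg_hom_pCons[OF assms(1), of a P])
  qed
qed simp

lemma aut_h_eq_smult:
  assumes "is_aut h \<sigma>" "h \<noteq> 0"
  obtains c where "c \<noteq> 0" "\<sigma> [:h:] = [:smult c h:]"
proof -
  have comm: "[:h:] = ahmult h gen_y gen_x - ahmult h gen_x gen_y"
    by (simp add: ahmult_y_left ymul_pCons Dh_def pderiv_pCons)
  have dvd: "\<exists>W. \<tau> [:h:] = smult h W" if "alg_hom h \<tau>" for \<tau>
    using commutator_dvd[of h "\<tau> gen_y" "\<tau> gen_x"]
    by (simp add: comm alg_hom_diff[OF that] alg_homD(3)[OF that] del: ahmult_const_left)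
  have hom: "alg_hom h \<sigma>" and bij: "bij \<sigma>"
    using assms by (auto simp: is_aut_iff)
  obtain W where W: "\<sigma> [:h:] = smult h W"
    using dvd hom by blast
  obtain V where V: "inv \<sigma> [:h:] = smult h V"
    using dvd alg_hom_inv[OF bij hom] by blast
  \<comment> \<open>Divisibility by \<open>h\<close> of both images gives
    \<open>h = h W \<sigma>(V)\<close>; cancelling \<open>h\<close> makes \<open>W\<close>
    invertible.\<close>
  have "[:h:] = \<sigma> (inv \<sigma> [:h:])"
    using bij by (simp add: bij_is_surj surj_f_inv_f)
  also have "\<dots> = ahmult h (\<sigma> [:h:]) (\<sigma> V)"
    unfolding V using alg_homD(3)[OF hom, of "[:h:]" V] by simp
  also have "\<dots> = smult h (ahmult h W (\<sigma> V))"
    by (simp add: W ahmult_smult_left)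
  finally have "smult h 1 = smult h (ahmult h W (\<sigma> V))"
    by simp
  then have 1: "ahmult h W (\<sigma> V) = 1"
    unfolding smult_left_cancel[OF assms(2)] by (rule sym)
  then have nz: "W \<noteq> 0" "\<sigma> V \<noteq> 0"
    by auto
  \<comment> \<open>Additivity of the degree leaves \<open>W\<close> and \<open>\<sigma> V\<close>
    free of \<open>y\<close>; there the units are the nonzero constants.\<close>
  have "degree W + degree (\<sigma> V) = 0"
    using degree_ahmult(2)[OF nz, where h = h] 1 by simp
  then obtain w v where wv: "W = [:w:]" "\<sigma> V = [:v:]"
    by (metis add_is_0 degree_eq_zeroE)
  then have "w * v = 1"
    using 1 by (simp add: one_pCons)
  then have "is_unit w"
    by (metis dvd_triv_left)
  then obtain c where "w = [:c:]" "c dvd 1"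
    by (auto simp: is_unit_poly_iff)
  moreover from this have "c \<noteq> 0"
    by auto
  ultimately have "w = [:c:]" "c \<noteq> 0"
    by blast+
  with that show thesis
    by (simp add: W wv mult.commute)
qed

lemma aut_classification:
  assumes "is_aut h \<sigma>" and deg: "degree h \<ge> 1"
  obtains \<alpha> \<beta> f where "(\<alpha>, \<beta>) \<in> PP h" "\<sigma> gen_x = [:[:\<beta>, \<alpha>:]:]"
    "\<sigma> gen_y = [:f, [:\<alpha> ^ (degree h - 1):]:]"
proof -
  have hom: "alg_hom h \<sigma>" and bij: "bij \<sigma>"
    using assms by (auto simp: is_aut_iff)
  have h0: "h \<noteq> 0"
    using deg by auto
  obtain c where c: "c \<noteq> 0" "\<sigma> [:h:] = [:smult c h:]"
    using aut_h_eq_smult[OF assms(1) h0] .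
  \<comment> \<open>Otherwise the image of \<open>h\<close> would involve \<open>y\<close>, whereas
    it is \<open>c h\<close>.\<close>
  have "degree (\<sigma> gen_x) = 0"
    using alg_hom_degree_const[OF hom _ h0] c deg by (cases "degree (\<sigma> gen_x) > 0") auto
  then obtain u where u: "\<sigma> gen_x = [:u:]"
    by (metis degree_eq_zeroE)
  note const = alg_hom_pcompose[OF hom u]
  have hu: "pcompose h u = smult c h"
    using c const[of h] by simp
  then have "degree h * degree u = degree h"
    using c by (simp flip: degree_pcompose)
  then have "degree u = 1"
    using deg by simp
  then obtain \<alpha> \<beta> where ab: "u = [:\<beta>, \<alpha>:]" "\<alpha> \<noteq> 0"
    by (metis degree_eq_zeroE degree_pCons_eq_if nat.inject One_nat_def pCons_cases pCons_eq_0_iff zero_neq_one)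
  have "lead_coeff (pcompose h u) = lead_coeff h * \<alpha> ^ degree h"
    using ab by (subst lead_coeff_comp) auto
  then have ca: "c = \<alpha> ^ degree h"
    using hu h0 c(1) by simp
  then have PP: "(\<alpha>, \<beta>) \<in> PP h"
    using hu ab by (simp add: PP_def)
  define Y where "Y = \<sigma> gen_y"
  obtain P where P: "\<sigma> P = gen_y"
    using bij by (metis bij_is_surj surjD)
  have "degree Y = 1"
  proof (cases "degree Y > 0")
    case True
    have "P \<noteq> 0"
      using P alg_hom_0[OF hom] by auto
    then have "degree (\<sigma> P) = degree P * degree Y"
      using alg_hom_degree[OF hom bij_is_inj[OF bij] _ True[unfolded Y_def], of P]
      by (simp add: const Y_def)
    then have "1 = degree P * degree Y"
      by (simp add: P)
    then show ?thesis
      by simp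
  next
    case False
    then obtain g where g: "Y = [:g:]"
      by (metis degree_eq_zeroE gr0I)
    \<comment> \<open>If both generators went to polynomials in \<open>x\<close>, so would
      everything, and \<open>y\<close> would have no preimage.\<close>
    have "degree (\<sigma> Q) = 0" for Q
    proof (induction Q)
      case (pCons a Q)
      obtain q where "\<sigma> Q = [:q:]"
        using pCons(2) by (metis degree_eq_zeroE)
      then show ?case
        by (simp add: alg_hom_pCons[OF hom, of a Q] const g flip: Y_def)
    qed (simp add: alg_hom_0[OF hom])
    from this[of P] show ?thesis
      by (simp add: P)
  qed
  then obtain f g where fg: "Y = [:f, g:]"
    by (metis degree_eq_zeroE degree_pCons_eq_if nat.inject One_nat_def pCons_cases zero_neq_one)
  \<comment> \<open>On applying \<open>\<sigma>\<close> to \<open>h = yx - xy\<close>, the part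
    \<open>f\<close> commutes with \<open>u\<close> and drops out; the remaining equation determines
    \<open>g\<close>.\<close>
  have "[:h:] = ahmult h gen_y gen_x - ahmult h gen_x gen_y"
    by (simp add: ahmult_y_left ymul_pCons Dh_def pderiv_pCons)
  then have "\<sigma> [:h:] = ahmult h Y [:u:] - ahmult h [:u:] Y"
    by (simp add: alg_hom_diff[OF hom] alg_homD(3)[OF hom] Y_def u del: ahmult_const_left)
  also have "\<dots> = [:g * (h * [:\<alpha>:]):]"
    by (simp add: fg ahmult_pCons_left ymul_pCons Dh_def ab pderiv_pCons mult.commute)
  finally have "h * smult \<alpha> g = h * [:\<alpha> ^ degree h:]"
    by (simp add: c ca mult_ac)
  then have "smult \<alpha> g = [:\<alpha> ^ degree h:]"
    using h0 by (metis mult_cancel_left)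
  also have "\<dots> = smult \<alpha> [:\<alpha> ^ (degree h - 1):]"
    using deg by (cases "degree h") simp_all
  finally have "g = [:\<alpha> ^ (degree h - 1):]"
    unfolding smult_left_cancel[OF ab(2)] .
  with that PP u ab fg Y_def show thesis
    by metis
qed

lemma AutCenter_eq:
  assumes "degree h \<ge> 1"
  shows "AutCenter h = phi h ` DZ h"
proof (intro equalityI subsetI)
  fix \<sigma> assume s: "\<sigma> \<in> AutCenter h"
  then have comm: "\<sigma> (\<tau> P) = \<tau> (\<sigma> P)" if "\<tau> \<in> Aut h" for \<tau> P
    using that by (auto simp: AutCenter_def Aut_def fun_eq_iff)
  have aut: "is_aut h \<sigma>"
    using s by (auto simp: AutCenter_def Aut_def)
  then have hom: "alg_hom h \<sigma>"
    by (simp add: is_aut_iff)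
  obtain \<alpha> \<beta> f where PP: "(\<alpha>, \<beta>) \<in> PP h" and x: "\<sigma> gen_x = [:[:\<beta>, \<alpha>:]:]"
    and y: "\<sigma> gen_y = [:f, [:\<alpha> ^ (degree h - 1):]:]"
    using aut_classification[OF aut assms] .
  \<comment> \<open>Commutation with \<open>phi h g\<close>, compared on \<open>y\<close>; the
    summand \<open>f\<close> cancels.\<close>
  have g: "pcompose g [:\<beta>, \<alpha>:] = smult (\<alpha> ^ (degree h - 1)) g" for g
  proof -
    have "\<sigma> (phi h g gen_y) = [:pcompose g [:\<beta>, \<alpha>:]:] + [:f, [:\<alpha> ^ (degree h - 1):]:]"
      using alg_homD(1)[OF hom, of "[:g:]" gen_y]
      by (simp add: phi_gen_y y alg_hom_pcompose[OF hom x])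
    moreover have "phi h g (\<sigma> gen_y) = [:f, 0:] + smult [:\<alpha> ^ (degree h - 1):] [:g, 1:]"
      by (simp add: y phi_linear)
    ultimately show ?thesis
      using comm[OF phi_in_Aut, of g gen_y] by (simp add: algebra_simps)
  qed
  \<comment> \<open>The choice \<open>g = 1\<close> removes the scalar, and then
    \<open>g = x\<close> gives \<open>\<alpha>x + \<beta> = x\<close>.\<close>
  have 1: "\<alpha> ^ (degree h - 1) = 1"
    using g[of 1] by (simp add: pcompose_1 one_pCons)
  have ab: "\<alpha> = 1" "\<beta> = 0"
    using g[of "[:0, 1:]"] 1 by (simp_all add: pcompose_pCons)
  have y1: "\<sigma> gen_y = [:f, 1:]"
    using y ab by (simp add: one_pCons)
  have "\<sigma> = phi h f"
    by (rule alg_hom_ext[OF hom alg_hom_phi]) (simp_all add: x ab y1 phi_gen_y phi_const)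
  moreover have "f \<in> DZ h"
    unfolding DZ_def
  proof safe
    fix \<zeta> \<epsilon> assume ze: "(\<zeta>, \<epsilon>) \<in> PP h"
    note tau = alg_hom_tau[OF ze assms]
    have "phi h f (tau h \<zeta> \<epsilon> gen_y) = [:smult (\<zeta> ^ (degree h - 1)) f, [:\<zeta> ^ (degree h - 1):]:]"
      by (simp add: tau_gen_y phi_linear)
    moreover have "tau h \<zeta> \<epsilon> (phi h f gen_y) = [:pcompose f [:\<epsilon>, \<zeta>:], [:\<zeta> ^ (degree h - 1):]:]"
      using alg_homD(1)[OF tau, of "[:f:]" gen_y]
      by (simp add: phi_gen_y tau_const[OF ze assms] tau_gen_y)
    ultimately show "pcompose f [:\<epsilon>, \<zeta>:] = smult (\<zeta> ^ (degree h - 1)) f"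
      using comm[OF tau_in_Aut[OF ze assms], of gen_y] \<open>\<sigma> = phi h f\<close> by simp
  qed
  ultimately show "\<sigma> \<in> phi h ` DZ h"
    by blast
next
  fix \<sigma> assume "\<sigma> \<in> phi h ` DZ h"
  then obtain r where r: "r \<in> DZ h" "\<sigma> = phi h r"
    by blast
  \<comment> \<open>By the classification it suffices to look at the generators; on \<open>y\<close>
    the two composites differ exactly by the defect in the condition defining
    \<open>DZ h\<close>.\<close>
  have "phi h r \<circ> \<tau> = \<tau> \<circ> phi h r" if "\<tau> \<in> Aut h" for \<tau>
  proof -
    have aut: "is_aut h \<tau>" and hom: "alg_hom h \<tau>"
      using that by (auto simp: Aut_def is_aut_iff)
    obtain \<alpha> \<beta> f where PP: "(\<alpha>, \<beta>) \<in> PP h" and x: "\<tau> gen_x = [:[:\<beta>, \<alpha>:]:]"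
      and y: "\<tau> gen_y = [:f, [:\<alpha> ^ (degree h - 1):]:]"
      using aut_classification[OF aut assms] .
    have rP: "pcompose r [:\<beta>, \<alpha>:] = smult (\<alpha> ^ (degree h - 1)) r"
      using r(1) PP by (auto simp: DZ_def)
    show ?thesis
    proof (rule alg_hom_ext[of h])
      show "(phi h r \<circ> \<tau>) gen_y = (\<tau> \<circ> phi h r) gen_y"
        using alg_homD(1)[OF hom, of "[:r:]" gen_y]
        by (simp add: phi_gen_y y phi_linear alg_hom_pcompose[OF hom x] rP)
    qed (simp_all add: alg_hom_comp alg_hom_phi hom phi_const x)
  qed
  then show "\<sigma> \<in> AutCenter h"
    using r by (simp add: AutCenter_def phi_in_Aut)
qed

section \<open>The invariants in the individual cases\<close>

lemma GG_iff: "\<nu> \<in> GG h \<longleftrightarrow> pcompose h [:\<nu>, 1:] = h"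
  by (simp add: GG_def PP_def)

lemma pcompose_translate:
  "pcompose (pcompose p [:\<mu>, 1:]) [:\<nu>, 1:] = pcompose p [:\<mu> + \<nu>, 1:]" for p :: "'a::field poly"
  by (simp add: pcompose_pCons flip: pcompose_assoc)

lemma GG_zero: "0 \<in> GG h"
  by (simp add: GG_iff)

lemma GG_add: "\<mu> \<in> GG h \<Longrightarrow> \<nu> \<in> GG h \<Longrightarrow> \<mu> + \<nu> \<in> GG h"
  by (simp add: GG_iff flip: pcompose_translate)

lemma GG_uminus:
  assumes "\<nu> \<in> GG h"
  shows "- \<nu> \<in> GG h"
proof -
  have "pcompose (pcompose h [:\<nu>, 1:]) [:- \<nu>, 1:] = h"
    by (simp add: pcompose_translate)
  then show ?thesis
    using assms by (simp add: GG_iff)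
qed

text \<open>Every \<open>\<nu>\<close> in the group satisfies \<open>h(\<nu>) = h(0)\<close>, so the
  group lies among the roots of the nonzero polynomial \<open>h - h(0)\<close>.\<close>

lemma finite_GG:
  assumes "degree h \<ge> 1"
  shows "finite (GG h)"
proof -
  have "h - [:poly h 0:] \<noteq> 0"
  proof
    assume "h - [:poly h 0:] = 0"
    then have "degree h = degree [:poly h 0:]"
      by simp
    then show False
      using assms by simp
  qed
  then have "finite {x. poly (h - [:poly h 0:]) x = 0}"
    by (rule poly_roots_finite)
  moreover have "GG h \<subseteq> {x. poly (h - [:poly h 0:]) x = 0}"
  proof
    fix \<nu> assume "\<nu> \<in> GG h"
    then have "poly (pcompose h [:\<nu>, 1:]) 0 = poly h 0"
      by (simp add: GG_iff)
    then show "\<nu> \<in> {x. poly (h - [:poly h 0:]) x = 0}"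
      by (simp add: poly_pcompose)
  qed
  ultimately show ?thesis
    by (rule rev_finite_subset)
qed

lemma prod_linear_dvd:
  fixes p :: "'a::field poly"
  assumes "finite A" "\<And>a. a \<in> A \<Longrightarrow> poly p (- a) = 0"
  shows "(\<Prod>a\<in>A. [:a, 1:]) dvd p"
  using assms
proof (induction A)
  case (insert b A)
  then obtain q where q: "p = (\<Prod>a\<in>A. [:a, 1:]) * q"
    by (auto simp: dvd_def)
  \<comment> \<open>As \<open>b\<close> is not in \<open>A\<close>, \<open>- b\<close> is no root of
    the earlier factors and must be a root of the cofactor \<open>q\<close>.\<close>
  have "poly (\<Prod>a\<in>A. [:a, 1:]) (- b) \<noteq> 0"
    using insert by (auto simp: poly_prod)
  then have "poly q (- b) = 0"
    using insert.prems[of b] q by simp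
  then have "[:b, 1:] dvd q"
    using poly_eq_0_iff_dvd[of q "- b"] by simp
  then show ?case
    unfolding q prod.insert[OF insert.hyps(1,2)] mult.commute[of "[:b, 1:]"] by (rule mult_dvd_mono[OF dvd_refl])
qed simp

text \<open>Translation by \<open>\<nu>\<close> maps the finite group injectively into itself and so
  permutes the linear factors.\<close>

lemma prod_translate:
  assumes "finite (GG h)" "\<nu> \<in> GG h"
  shows "pcompose (\<Prod>\<mu>\<in>GG h. [:\<mu>, 1:]) [:\<nu>, 1:] = (\<Prod>\<mu>\<in>GG h. [:\<mu>, 1:])"
proof -
  have "(\<lambda>\<mu>. \<mu> + \<nu>) ` GG h = GG h"
    by (rule card_subset_eq) (use assms in \<open>auto simp: GG_add card_image\<close>)
  then have "bij_betw (\<lambda>\<mu>. \<mu> + \<nu>) (GG h) (GG h)"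
    by (simp add: bij_betw_def)
  then have "(\<Prod>\<mu>\<in>GG h. [:\<mu>, 1:]) = (\<Prod>\<mu>\<in>GG h. [:\<mu> + \<nu>, 1:])"
    by (rule prod.reindex_bij_betw[symmetric])
  also have "\<dots> = pcompose (\<Prod>\<mu>\<in>GG h. [:\<mu>, 1:]) [:\<nu>, 1:]"
    by (simp add: pcompose_prod pcompose_pCons add.commute)
  finally show ?thesis ..
qed

lemma degree_prod_linear: "finite A \<Longrightarrow> degree (\<Prod>a\<in>A. [:a, 1 :: 'a::field:]) = card A"
  using degree_prod_eq_sum_degree[of A "\<lambda>a. [:a, 1:]"] by simp

text \<open>Splitting off \<open>r(0)\<close>, the remainder vanishes on the group and is therefore \<open>t\<close> times
  an invariant of smaller degree.\<close>

lemma translation_invariant_imp_pcompose: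
  fixes h :: "'a::field poly"
  assumes fin: "finite (GG h)" and inv: "\<And>\<nu>. \<nu> \<in> GG h \<Longrightarrow> pcompose r [:\<nu>, 1:] = r"
  shows "\<exists>p. r = pcompose p (\<Prod>\<nu>\<in>GG h. [:\<nu>, 1:])"
  using inv
proof (induction "degree r" arbitrary: r rule: less_induct)
  case less
  define t :: "'a poly" where "t = (\<Prod>\<nu>\<in>GG h. [:\<nu>, 1:])"
  have degt: "degree t \<ge> 1"
    using fin GG_zero[of h] by (simp add: t_def degree_prod_linear Suc_le_eq card_gt_0_iff) auto
  have "poly (r - [:poly r 0:]) (- \<nu>) = 0" if "\<nu> \<in> GG h" for \<nu>
  proof -
    have "poly (pcompose r [:- \<nu>, 1:]) 0 = poly r 0"
      using less.prems GG_uminus[OF that] by simp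
    then show ?thesis
      by (simp add: poly_pcompose)
  qed
  then have "t dvd r - [:poly r 0:]"
    unfolding t_def using fin by (intro prod_linear_dvd)
  then obtain q where q: "r - [:poly r 0:] = t * q"
    by (auto simp: dvd_def)
  then have r: "r = [:poly r 0:] + t * q"
    by (simp add: algebra_simps)
  have "\<exists>p. q = pcompose p t"
  proof (cases "q = 0")
    case True
    then show ?thesis
      by (metis pcompose_0)
  next
    case False
    have "t \<noteq> 0"
      using degt by auto
    have "degree r = degree (r - [:poly r 0:])"
      using degree_add_eq_right[of "[:poly r 0:]" "t * q"] r False degt
      by (metis add_gr_0 degree_mult_eq degree_pCons_0 less_le_trans q zero_less_one \<open>t \<noteq> 0\<close>)
    also have "\<dots> = degree t + degree q"
      using False \<open>t \<noteq> 0\<close> by (simp add: q degree_mult_eq)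
    finally have "degree q < degree r"
      using degt by simp
    moreover have "pcompose q [:\<nu>, 1:] = q" if "\<nu> \<in> GG h" for \<nu>
    proof -
      have "pcompose (r - [:poly r 0:]) [:\<nu>, 1:] = r - [:poly r 0:]"
        using less.prems[OF that] by (simp add: pcompose_diff)
      then have "t * pcompose q [:\<nu>, 1:] = t * q"
        using prod_translate[OF fin that] unfolding q by (simp add: pcompose_mult t_def)
      then show ?thesis
        using \<open>t \<noteq> 0\<close> by simp
    qed
    ultimately show ?thesis
      using less.hyps unfolding t_def by blast
  qed
  then obtain p where "q = pcompose p t"
    by blast
  then have "r = pcompose (pCons (poly r 0) p) t"
    using r by (simp add: pcompose_pCons)
  then show ?case
    unfolding t_def by blast
qed

lemma DZ_translations:
  assumes deg: "degree h \<ge> 1" and "tauP h = tau h 1 ` GG h"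
  shows "DZ h = {pcompose p (\<Prod>\<nu>\<in>GG h. [:\<nu>, 1:]) | p. True}"
proof -
  \<comment> \<open>The image of \<open>x\<close> determines the parameters, so the equality of sets
    of automorphisms restricts the pairs themselves.\<close>
  have PP: "\<zeta> = 1 \<and> \<epsilon> \<in> GG h" if "(\<zeta>, \<epsilon>) \<in> PP h" for \<zeta> \<epsilon>
  proof -
    have "tau h \<zeta> \<epsilon> \<in> tau h 1 ` GG h"
      using that assms(2) by (force simp: tauP_def)
    then obtain \<nu> where "\<nu> \<in> GG h" "tau h \<zeta> \<epsilon> gen_x = tau h 1 \<nu> gen_x"
      by auto
    then show ?thesis
      unfolding tau_gen_x by simp
  qed
  have "r \<in> DZ h \<longleftrightarrow> (\<forall>\<nu>\<in>GG h. pcompose r [:\<nu>, 1:] = r)" for r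
    using PP by (force simp: DZ_def GG_def)
  then show ?thesis
    using translation_invariant_imp_pcompose[OF finite_GG[OF deg]] prod_translate[OF finite_GG[OF deg]]
    by (auto simp flip: pcompose_assoc)
qed

section \<open>Scalings and powers of a linear polynomial\<close>

lemma pcompose_power: "pcompose (p ^ n) q = pcompose p q ^ n"
  by (induction n) (simp_all add: pcompose_mult pcompose_1)

text \<open>A nonzero coefficient would give \<open>\<zeta> ^ k = \<zeta> ^ m\<close> for all
  nonzero \<open>\<zeta>\<close>, that is, infinitely many roots of a nonzero polynomial.\<close>

lemma scaling_coeff_zero:
  fixes s :: "'a::field poly"
  assumes "infinite (UNIV :: 'a set)" "\<And>\<zeta>. \<zeta> \<noteq> 0 \<Longrightarrow> pcompose s [:0, \<zeta>:] = smult (\<zeta> ^ m) s" "k \<noteq> m"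
  shows "coeff s k = 0"
proof (rule ccontr)
  assume k: "coeff s k \<noteq> 0"
  have "\<zeta> ^ k = \<zeta> ^ m" if "\<zeta> \<noteq> 0" for \<zeta> :: 'a
  proof -
    have "coeff (pcompose s [:0, \<zeta>:]) k = \<zeta> ^ m * coeff s k"
      using assms(2)[OF that] by simp
    then show ?thesis
      using k by (simp add: coeff_pcompose_linear)
  qed
  then have "UNIV - {0::'a} \<subseteq> {\<zeta>. poly (monom 1 k - monom 1 m) \<zeta> = 0}"
    by (auto simp: poly_monom)
  moreover have "monom 1 k - monom 1 m \<noteq> (0 :: 'a poly)"
    using assms(3) by (simp add: monom_eq_iff')
  then have "finite {\<zeta>::'a. poly (monom 1 k - monom 1 m) \<zeta> = 0}"
    by (rule poly_roots_finite)
  ultimately have "finite (UNIV - {0::'a})"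
    by (rule finite_subset)
  then show False
    using assms(1) by simp
qed

text \<open>The substitutions are the dilations about the only root \<open>lam\<close>; once it is
  moved to the origin, the condition for all scalings leaves multiples of a single monomial.\<close>

lemma DZ_linear_power:
  fixes lam :: "'a::field"
  assumes "\<gamma> \<noteq> 0" "n \<ge> 1" and h: "h = smult \<gamma> ([:- lam, 1:] ^ n)" and inf: "infinite (UNIV :: 'a set)"
  shows "DZ h = {smult c ([:- lam, 1:] ^ (n - 1)) | c. True}"
proof -
  have deg: "degree h = n"
    using assms(1) by (simp add: h degree_linear_power)
  have lin: "pcompose [:- lam, 1:] [:lam - \<zeta> * lam, \<zeta>:] = smult \<zeta> [:- lam, 1:]" for \<zeta>
    by (simp add: pcompose_pCons)
  have pow: "pcompose ([:- lam, 1:] ^ k) [:lam - \<zeta> * lam, \<zeta>:] = smult (\<zeta> ^ k) ([:- lam, 1:] ^ k)" for \<zeta> k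
    by (simp only: pcompose_power lin smult_power)
  have PP: "(\<zeta>, lam - \<zeta> * lam) \<in> PP h" if "\<zeta> \<noteq> 0" for \<zeta>
    unfolding PP_def deg using that
    by (simp add: h pcompose_smult pow mult.commute)
  \<comment> \<open>The value at \<open>lam\<close> shows that
    \<open>\<zeta> lam + \<epsilon>\<close> is a root of \<open>h\<close>, and \<open>lam\<close> is
    the only one.\<close>
  have PPD: "\<epsilon> = lam - \<zeta> * lam" if "(\<zeta>, \<epsilon>) \<in> PP h" for \<zeta> \<epsilon>
  proof -
    have "poly (pcompose h [:\<epsilon>, \<zeta>:]) lam = 0"
      using that assms(2) by (simp add: PP_def) (simp add: h)
    then have "\<epsilon> + lam * \<zeta> - lam = 0"
      using assms(1,2) by (simp add: h poly_pcompose)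
    then show ?thesis
      by (simp add: algebra_simps)
  qed
  have "r \<in> {smult c ([:- lam, 1:] ^ (n - 1)) | c. True}" if "r \<in> DZ h" for r
  proof -
    define s where "s = pcompose r [:lam, 1:]"
    have r: "r = pcompose s [:- lam, 1:]"
      by (simp add: s_def pcompose_translate)
    have "pcompose s [:0, \<zeta>:] = smult (\<zeta> ^ (n - 1)) s" if "\<zeta> \<noteq> 0" for \<zeta>
    proof -
      have "pcompose r [:lam - \<zeta> * lam, \<zeta>:] = smult (\<zeta> ^ (n - 1)) r"
        using \<open>r \<in> DZ h\<close> PP[OF that] deg by (auto simp: DZ_def)
      then have "pcompose (pcompose r [:lam - \<zeta> * lam, \<zeta>:]) [:lam, 1:] = smult (\<zeta> ^ (n - 1)) s"
        by (simp add: s_def pcompose_smult)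
      then show ?thesis
        by (simp add: s_def pcompose_pCons mult.commute flip: pcompose_assoc)
    qed
    then have "coeff s k = 0" if "k \<noteq> n - 1" for k
      using scaling_coeff_zero[OF inf _ that] by blast
    then have s: "s = monom (coeff s (n - 1)) (n - 1)"
      by (intro poly_eqI) simp
    have pcompose_gen: "pcompose [:0, 1:] [:- lam, 1:] = [:- lam, 1:]"
      by (simp add: pcompose_pCons)
    have "s = smult (coeff s (n - 1)) ([:0, 1:] ^ (n - 1))"
      by (subst s) (simp add: monom_altdef)
    then have "r = smult (coeff s (n - 1)) ([:- lam, 1:] ^ (n - 1))"
      using r by (metis pcompose_smult pcompose_power pcompose_gen)
    then show ?thesis
      by blast
  qed
  moreover have "smult c ([:- lam, 1:] ^ (n - 1)) \<in> DZ h" for c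
    unfolding DZ_def deg
    by (auto dest!: PPD simp: pcompose_smult pow mult.commute)
  ultimately show ?thesis
    by blast
qed

section \<open>Powers of a primitive root and the semidirect case\<close>

lemma prim_root_power_eq:
  fixes \<alpha> :: "'a::field"
  assumes "prim_root \<alpha> l" "l > 0"
  shows "\<alpha> ^ i = \<alpha> ^ j \<longleftrightarrow> i mod l = j mod l"
proof -
  have min: "\<alpha> ^ k \<noteq> 1" if "0 < k" "k < l" for k
    using assms that by (auto simp: prim_root_def)
  have a: "\<alpha> ^ l = 1"
    using assms by (auto simp: prim_root_def)
  then have nz: "\<alpha> \<noteq> 0"
    using assms(2) by (auto simp: power_0_left)
  have red: "\<alpha> ^ k = \<alpha> ^ (k mod l)" for k
    by (metis a div_mult_mod_eq mult.commute mult_1 power_add power_mult power_one)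
  have neq: "\<alpha> ^ i \<noteq> \<alpha> ^ j" if "i < j" "j < l" for i j
  proof
    assume "\<alpha> ^ i = \<alpha> ^ j"
    also have "\<alpha> ^ j = \<alpha> ^ i * \<alpha> ^ (j - i)"
      using that by (simp flip: power_add)
    finally have "\<alpha> ^ (j - i) = 1"
      using nz by simp
    then show False
      using min[of "j - i"] that by simp
  qed
  have "i mod l = j mod l" if "\<alpha> ^ (i mod l) = \<alpha> ^ (j mod l)"
    using neq[of "i mod l" "j mod l"] neq[of "j mod l" "i mod l"] that assms(2)
    by (metis linorder_neqE_nat mod_less_divisor)
  then show ?thesis
    using red by metis
qed

text \<open>Conjugating translation by \<open>\<nu>\<close> with the affine map gives translation by
  \<open>\<nu> / \<alpha>\<close>. Hence division by \<open>\<alpha>\<close> permutes the group, and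
  each linear factor contributes one \<open>\<alpha>\<close>.\<close>

lemma prod_GG_scale:
  assumes "finite (GG h)" "(\<alpha>, \<beta>) \<in> PP h"
  shows "pcompose (\<Prod>\<nu>\<in>GG h. [:\<nu>, 1:]) [:0, \<alpha>:] = smult (\<alpha> ^ card (GG h)) (\<Prod>\<nu>\<in>GG h. [:\<nu>, 1:])"
proof -
  have a: "\<alpha> \<noteq> 0" and e: "pcompose h [:\<beta>, \<alpha>:] = smult (\<alpha> ^ degree h) h"
    using assms by (auto simp: PP_def)
  have "\<nu> / \<alpha> \<in> GG h" if "\<nu> \<in> GG h" for \<nu>
  proof -
    have "smult (\<alpha> ^ degree h) (pcompose h [:\<nu> / \<alpha>, 1:]) = pcompose (pcompose h [:\<nu>, 1:]) [:\<beta>, \<alpha>:]"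
      using a by (simp add: e[symmetric] pcompose_pCons add.commute flip: pcompose_assoc pcompose_smult)
    also have "\<dots> = smult (\<alpha> ^ degree h) h"
      using that e by (simp add: GG_iff)
    finally show ?thesis
      using a by (simp add: GG_iff smult_left_cancel)
  qed
  then have "(\<lambda>\<nu>. \<nu> / \<alpha>) ` GG h = GG h"
    by (intro card_subset_eq) (use assms a in \<open>auto simp: card_image inj_on_def\<close>)
  then have "bij_betw (\<lambda>\<nu>. \<nu> / \<alpha>) (GG h) (GG h)"
    using a by (auto simp: bij_betw_def inj_on_def)
  then have "(\<Prod>\<nu>\<in>GG h. [:\<nu>, 1:]) = (\<Prod>\<nu>\<in>GG h. [:\<nu> / \<alpha>, 1:])"
    by (rule prod.reindex_bij_betw[symmetric])
  then have "smult (\<alpha> ^ card (GG h)) (\<Prod>\<nu>\<in>GG h. [:\<nu>, 1:]) = (\<Prod>\<nu>\<in>GG h. smult \<alpha> [:\<nu> / \<alpha>, 1:])"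
    by (simp only: prod_smult prod_constant)
  also have "\<dots> = pcompose (\<Prod>\<nu>\<in>GG h. [:\<nu>, 1:]) [:0, \<alpha>:]"
    using a by (simp add: pcompose_prod pcompose_pCons)
  finally show ?thesis ..
qed

text \<open>The coefficient of \<open>x\<close> in \<open>t\<close> is the product of the nonzero elements of the group; comparing
  it in \<open>t(\<alpha>x) = \<alpha>\<^bsup>|G|\<^esup> t(x)\<close> yields the claim.\<close>

lemma power_card_GG:
  assumes "finite (GG h)" "(\<alpha>, \<beta>) \<in> PP h"
  shows "\<alpha> ^ card (GG h) = \<alpha>"
proof -
  define t where "t = (\<Prod>\<nu>\<in>GG h. [:\<nu>, 1:])"
  have t: "t = [:0, 1:] * (\<Prod>\<nu>\<in>GG h - {0}. [:\<nu>, 1:])"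
    unfolding t_def using assms(1) GG_zero by (rule prod.remove)
  have "coeff t 1 = poly (\<Prod>\<nu>\<in>GG h - {0}. [:\<nu>, 1:]) 0"
    by (simp add: t poly_0_coeff_0)
  also have "\<dots> = (\<Prod>\<nu>\<in>GG h - {0}. \<nu>)"
    by (simp add: poly_prod)
  finally have "coeff t 1 \<noteq> 0"
    using assms(1) by simp
  moreover have "\<alpha> * coeff t 1 = \<alpha> ^ card (GG h) * coeff t 1"
    using arg_cong[OF prod_GG_scale[OF assms], of "\<lambda>p. coeff p 1"]
    by (simp add: coeff_pcompose_linear flip: t_def)
  ultimately show ?thesis
    by simp
qed

lemma pcompose_eq_sum: "pcompose p s = (\<Sum>k\<le>degree p. smult (coeff p k) (s ^ k))"
proof -
  have monom: "pcompose (monom c k) s = smult c (s ^ k)" for c k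
    by (simp add: monom_altdef pcompose_smult pcompose_power pcompose_pCons)
  have "pcompose p s = pcompose (\<Sum>k\<le>degree p. monom (coeff p k) k) s"
    by (simp add: poly_as_sum_of_monoms)
  then show ?thesis
    by (simp add: pcompose_sum monom)
qed

text \<open>Each exponent that occurs is \<open>n + l * (k div l)\<close>, so \<open>s ^ n\<close>
  factors out and powers of \<open>s ^ l\<close> remain.\<close>

lemma pcompose_residue_class:
  fixes p s :: "'a::field poly"
  assumes "\<And>k. coeff p k \<noteq> 0 \<Longrightarrow> k mod l = n"
  shows "\<exists>p'. pcompose p s = s ^ n * pcompose p' (s ^ l)"
proof -
  \<comment> \<open>Arbitrary index sets allow an induction that adds one exponent at a
    time.\<close>
  have "\<exists>p'. (\<Sum>k\<in>A. smult (coeff p k) (s ^ k)) = s ^ n * pcompose p' (s ^ l)" for A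
  proof (induction A rule: infinite_finite_induct)
    case (insert k A)
    then obtain p' where p': "(\<Sum>k\<in>A. smult (coeff p k) (s ^ k)) = s ^ n * pcompose p' (s ^ l)"
      by blast
    show ?case
    proof (cases "coeff p k = 0")
      case True
      then show ?thesis
        using insert p' by auto
    next
      case False
      then have "k = n + l * (k div l)"
        using assms[of k] by (metis mod_mult_div_eq)
      then have "s ^ k = s ^ n * (s ^ l) ^ (k div l)"
        by (metis power_add power_mult)
      then have "smult (coeff p k) (s ^ k) = s ^ n * pcompose (smult (coeff p k) ([:0, 1:] ^ (k div l))) (s ^ l)"
        by (simp add: pcompose_smult pcompose_power pcompose_pCons)
      then have "(\<Sum>k\<in>insert k A. smult (coeff p k) (s ^ k))
          = s ^ n * pcompose (smult (coeff p k) ([:0, 1:] ^ (k div l)) + p') (s ^ l)"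
        using insert by (simp add: p' pcompose_add distrib_left)
      then show ?thesis ..
    qed
  qed (auto intro!: exI[of _ 0])
  then show ?thesis
    unfolding pcompose_eq_sum[of p s] by blast
qed

text \<open>The affine map fixes \<open>-c\<close> for the \<open>c\<close> below, so after a shift
  it is a scaling. Translation invariance makes \<open>r\<close> a polynomial in the shifted product
  \<open>s\<close>, and \<open>s\<close> has eigenvalue \<open>\<alpha>\<close>; the condition at
  \<open>\<alpha>\<close> then selects the exponents congruent to \<open>degree h - 1\<close> modulo
  \<open>l\<close>.\<close>

lemma DZ_semidirect:
  fixes h :: "'a::field poly"
  assumes deg: "degree h \<ge> 1" and l: "l > 1" and prim: "prim_root \<alpha> l" and ab: "(\<alpha>, \<beta>) \<in> PP h"
    and tauP: "tauP h = {tau h 1 \<nu> \<circ> (tau h \<alpha> \<beta> ^^ k) | \<nu> k. \<nu> \<in> GG h}"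
  shows "(\<exists>n < l. (n * card (GG h)) mod l = (degree h - 1) mod l)
    \<and> (\<forall>n < l. (n * card (GG h)) mod l = (degree h - 1) mod l \<longrightarrow>
         DZ h = {(\<Prod>\<nu>\<in>GG h. [:\<beta> / (\<alpha> - 1) + \<nu>, 1:] ^ n)
                  * pcompose p (\<Prod>\<nu>\<in>GG h. [:\<beta> / (\<alpha> - 1) + \<nu>, 1:] ^ l) | p. True})"
proof (intro conjI allI impI)
  note fin = finite_GG[OF deg]
  note root_eq = prim_root_power_eq[OF prim]
  have a0: "\<alpha> \<noteq> 0" and a1: "\<alpha> \<noteq> 1"
    using ab prim l by (auto simp: PP_def prim_root_def dest: spec[of _ 1])
  have "\<alpha> ^ card (GG h) = \<alpha> ^ 1"
    using power_card_GG[OF fin ab] by simp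
  then have card_mod: "card (GG h) mod l = 1"
    using root_eq[of "card (GG h)" 1] l by simp
  \<comment> \<open>As \<open>card (GG h)\<close> is \<open>1\<close> modulo \<open>l\<close>, the
    congruence prescribes the residue of \<open>n\<close> itself.\<close>
  have mod_eq: "n * card (GG h) mod l = n mod l" for n
    by (metis card_mod mod_mult_right_eq mult.right_neutral)
  show "\<exists>n<l. n * card (GG h) mod l = (degree h - 1) mod l"
    using l by (intro exI[of _ "(degree h - 1) mod l"]) (simp add: mod_eq)

  fix n assume n: "n < l" "n * card (GG h) mod l = (degree h - 1) mod l"
  then have nmod: "n = (degree h - 1) mod l"
    by (simp add: mod_eq)
  have an: "\<alpha> ^ n = \<alpha> ^ (degree h - 1)"
    using root_eq l by (simp add: nmod)
  define c where "c = \<beta> / (\<alpha> - 1)"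
  define t :: "'a poly" where "t = (\<Prod>\<nu>\<in>GG h. [:\<nu>, 1:])"
  define s where "s = pcompose t [:c, 1:]"
  have s: "s = (\<Prod>\<nu>\<in>GG h. [:c + \<nu>, 1:])"
    by (simp add: s_def t_def pcompose_prod pcompose_pCons add.commute)
  have prod: "(\<Prod>\<nu>\<in>GG h. [:\<beta> / (\<alpha> - 1) + \<nu>, 1:] ^ m) = s ^ m" for m
    by (simp add: s c_def prod_power_distrib)
  have degs: "degree s > 0"
    using fin GG_zero[of h] by (auto simp: s_def t_def degree_pcompose degree_prod_linear card_gt_0_iff)
  have fixed: "c + \<beta> = \<alpha> * c"
    using a1 by (simp add: c_def field_simps)
  have "pcompose s [:\<beta>, \<alpha>:] = pcompose (pcompose t [:0, \<alpha>:]) [:c, 1:]"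
    by (simp add: s_def pcompose_pCons fixed flip: pcompose_assoc)
  also have "\<dots> = smult \<alpha> s"
    by (simp add: t_def prod_GG_scale[OF fin ab] power_card_GG[OF fin ab] pcompose_smult s_def)
  finally have s_ab: "pcompose s [:\<beta>, \<alpha>:] = smult \<alpha> s" .
  have s_nu: "pcompose s [:\<nu>, 1:] = s" if "\<nu> \<in> GG h" for \<nu>
  proof -
    have "pcompose s [:\<nu>, 1:] = pcompose (pcompose t [:\<nu>, 1:]) [:c, 1:]"
      by (simp add: s_def pcompose_translate add.commute)
    then show ?thesis
      using prod_translate[OF fin that] by (simp add: t_def s_def)
  qed

  have "\<exists>p. r = s ^ n * pcompose p (s ^ l)" if r: "r \<in> DZ h" for r
  proof -
    have r_nu: "pcompose r [:\<nu>, 1:] = r" if "\<nu> \<in> GG h" for \<nu>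
      using r that by (auto simp: DZ_def GG_def)
    have "\<exists>p. pcompose r [:- c, 1:] = pcompose p t"
      unfolding t_def
    proof (rule translation_invariant_imp_pcompose[OF fin])
      fix \<nu> assume "\<nu> \<in> GG h"
      have "pcompose (pcompose r [:- c, 1:]) [:\<nu>, 1:] = pcompose (pcompose r [:\<nu>, 1:]) [:- c, 1:]"
        by (simp add: pcompose_translate add.commute)
      with r_nu[OF \<open>\<nu> \<in> GG h\<close>] show "pcompose (pcompose r [:- c, 1:]) [:\<nu>, 1:] = pcompose r [:- c, 1:]"
        by simp
    qed
    then obtain p where p: "pcompose r [:- c, 1:] = pcompose p t" ..
    have "r = pcompose (pcompose r [:- c, 1:]) [:c, 1:]"
      by (simp add: pcompose_translate)
    then have rs: "r = pcompose p s"
      by (simp add: p s_def pcompose_assoc)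
    have "pcompose r [:\<beta>, \<alpha>:] = smult (\<alpha> ^ (degree h - 1)) r"
      using r ab by (auto simp: DZ_def)
    moreover have "pcompose r [:\<beta>, \<alpha>:] = pcompose (pcompose p [:0, \<alpha>:]) s"
      by (simp add: rs s_ab pcompose_pCons flip: pcompose_assoc)
    ultimately have "pcompose (pcompose p [:0, \<alpha>:] - smult (\<alpha> ^ (degree h - 1)) p) s = 0"
      by (simp add: pcompose_diff pcompose_smult rs)
    \<comment> \<open>\<open>s\<close> is not constant, so a polynomial in \<open>s\<close> vanishes
      only if its coefficients do.\<close>
    then have "pcompose p [:0, \<alpha>:] - smult (\<alpha> ^ (degree h - 1)) p = 0"
      using degs by (rule pcompose_eq_0)
    then have coeffs: "\<alpha> ^ k * coeff p k = \<alpha> ^ (degree h - 1) * coeff p k" for k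
      by (metis coeff_pcompose_linear coeff_smult eq_iff_diff_eq_0)
    have "k mod l = n" if "coeff p k \<noteq> 0" for k
      using that coeffs[of k] root_eq[of k "degree h - 1"] l nmod by simp
    then show ?thesis
      unfolding rs by (rule pcompose_residue_class)
  qed
  moreover have "s ^ n * pcompose p (s ^ l) \<in> DZ h" for p
  proof -
    define r where "r = s ^ n * pcompose p (s ^ l)"
    have "\<alpha> ^ l = 1"
      using prim by (simp add: prim_root_def)
    then have r_ab: "pcompose r [:\<beta>, \<alpha>:] = smult (\<alpha> ^ (degree h - 1)) r"
      by (simp add: r_def pcompose_mult pcompose_power s_ab smult_power an flip: pcompose_assoc)
    have r_nu: "pcompose r [:\<nu>, 1:] = r" if "\<nu> \<in> GG h" for \<nu>
      using s_nu[OF that] by (simp add: r_def pcompose_mult pcompose_power flip: pcompose_assoc)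
    \<comment> \<open>Elements of \<open>tauP h\<close> are given as composites, so they are
      evaluated on \<open>r\<close> and on \<open>x\<close> instead of composing their
      parameters.\<close>
    have pow_r: "(tau h \<alpha> \<beta> ^^ k) [:r:] = [:smult ((\<alpha> ^ k) ^ (degree h - 1)) r:]" for k
      by (induction k)
         (simp_all add: tau_const[OF ab deg] pcompose_smult r_ab power_mult_distrib mult.commute)
    have pow_x: "\<exists>b. (tau h \<alpha> \<beta> ^^ k) gen_x = [:[:b, \<alpha> ^ k:]:]" for k
      by (induction k) (auto simp: tau_const[OF ab deg] pcompose_pCons mult.commute)
    have "pcompose r [:\<epsilon>, \<zeta>:] = smult (\<zeta> ^ (degree h - 1)) r" if ze: "(\<zeta>, \<epsilon>) \<in> PP h" for \<zeta> \<epsilon>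
    proof -
      have "tau h \<zeta> \<epsilon> \<in> tauP h"
        using ze by (force simp: tauP_def)
      then obtain \<nu> k where \<nu>: "\<nu> \<in> GG h" and eq: "tau h \<zeta> \<epsilon> = tau h 1 \<nu> \<circ> (tau h \<alpha> \<beta> ^^ k)"
        unfolding tauP by blast
      have PP\<nu>: "(1, \<nu>) \<in> PP h"
        using \<nu> by (simp add: GG_def)
      obtain b where b: "(tau h \<alpha> \<beta> ^^ k) gen_x = [:[:b, \<alpha> ^ k:]:]"
        using pow_x by blast
      have "[:[:\<epsilon>, \<zeta>:]:] = tau h 1 \<nu> [:[:b, \<alpha> ^ k:]:]"
        using fun_cong[OF eq, of gen_x] by (simp only: tau_gen_x b comp_apply)
      then have \<zeta>: "\<zeta> = \<alpha> ^ k"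
        by (simp add: tau_const[OF PP\<nu> deg] pcompose_pCons)
      have "[:pcompose r [:\<epsilon>, \<zeta>:]:] = tau h 1 \<nu> [:smult ((\<alpha> ^ k) ^ (degree h - 1)) r:]"
        using fun_cong[OF eq, of "[:r:]"] by (simp only: tau_const[OF ze deg] pow_r comp_apply)
      also have "\<dots> = [:smult ((\<alpha> ^ k) ^ (degree h - 1)) r:]"
        by (simp add: tau_const[OF PP\<nu> deg] pcompose_smult r_nu[OF \<nu>])
      finally show ?thesis
        by (simp add: \<zeta>)
    qed
    then show ?thesis
      by (auto simp: DZ_def r_def)
  qed
  ultimately show "DZ h = {(\<Prod>\<nu>\<in>GG h. [:\<beta> / (\<alpha> - 1) + \<nu>, 1:] ^ n)
      * pcompose p (\<Prod>\<nu>\<in>GG h. [:\<beta> / (\<alpha> - 1) + \<nu>, 1:] ^ l) | p. True}"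
    unfolding prod by blast
qed

text \<open>Every \<open>phi h f\<close> fixes \<open>x\<close>, so a \<open>tau\<close> among them
  must have the parameters \<open>(1, 0)\<close>.\<close>

lemma DZ_UNIV:
  assumes "Aut h = range (phi h)" "degree h \<ge> 1"
  shows "DZ h = UNIV"
proof -
  have "\<zeta> = 1 \<and> \<epsilon> = 0" if "(\<zeta>, \<epsilon>) \<in> PP h" for \<zeta> \<epsilon>
  proof -
    obtain f where "tau h \<zeta> \<epsilon> = phi h f"
      using tau_in_Aut[OF \<open>(\<zeta>, \<epsilon>) \<in> PP h\<close> assms(2)] assms(1) by auto
    then have "tau h \<zeta> \<epsilon> gen_x = phi h f gen_x"
      by simp
    then show ?thesis
      unfolding tau_gen_x phi_gen_x by simp
  qed
  then have "PP h \<subseteq> {(1, 0)}"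
    by auto
  then show ?thesis
    by (auto simp: DZ_def)
qed

text \<open>Differentiating the identity that defines \<open>PP h\<close> yields a factor
  \<open>\<zeta>\<close> on the left, which cancels one power on the right.\<close>

lemma pderiv_in_DZ:
  assumes "degree h \<ge> 1"
  shows "smult c (pderiv h) \<in> DZ h"
proof -
  have "pcompose (pderiv h) [:\<epsilon>, \<zeta>:] = smult (\<zeta> ^ (degree h - 1)) (pderiv h)"
    if "(\<zeta>, \<epsilon>) \<in> PP h" for \<zeta> \<epsilon>
  proof -
    have z: "\<zeta> \<noteq> 0" and e: "pcompose h [:\<epsilon>, \<zeta>:] = smult (\<zeta> ^ degree h) h"
      using that by (auto simp: PP_def)
    have "smult \<zeta> (pcompose (pderiv h) [:\<epsilon>, \<zeta>:]) = pderiv (pcompose h [:\<epsilon>, \<zeta>:])"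
      by (simp add: pderiv_pcompose pderiv_pCons)
    also have "\<dots> = smult \<zeta> (smult (\<zeta> ^ (degree h - 1)) (pderiv h))"
      unfolding e using assms by (cases "degree h") (simp_all add: pderiv_smult)
    finally show ?thesis
      unfolding smult_left_cancel[OF z] .
  qed
  then show ?thesis
    by (auto simp: DZ_def pcompose_smult mult.commute)
qed

theorem theorem8p12:
  fixes h :: "'a::field poly"
  assumes "degree h \<ge> 1"
  shows "AutCenter h = phi h ` DZ h
    \<and> (Aut h = range (phi h) \<longrightarrow> DZ h = UNIV \<and> AutCenter h = Aut h)
    \<and> (tauP h = tau h 1 ` GG h \<longrightarrow>
         DZ h = {pcompose p (\<Prod>\<nu>\<in>GG h. [:\<nu>, 1:]) | p. True})
    \<and> (\<forall>(\<gamma>::'a) lam n. \<gamma> \<noteq> 0 \<and> n \<ge> 1 \<and> h = smult \<gamma> ([:- lam, 1:] ^ n)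
          \<and> infinite (UNIV :: 'a set) \<longrightarrow>
         DZ h = {smult c ([:- lam, 1:] ^ (n - 1)) | c. True})
    \<and> (\<forall>\<alpha> \<beta> l. l > 1 \<and> prim_root \<alpha> l \<and> (\<alpha>, \<beta>) \<in> PP h
          \<and> tauP h = {tau h 1 \<nu> \<circ> (tau h \<alpha> \<beta> ^^ k) | \<nu> k. \<nu> \<in> GG h} \<longrightarrow>
         (\<exists>n < l. (n * card (GG h)) mod l = (degree h - 1) mod l)
         \<and> (\<forall>n < l. (n * card (GG h)) mod l = (degree h - 1) mod l \<longrightarrow>
             DZ h = {(\<Prod>\<nu>\<in>GG h. [:\<beta> / (\<alpha> - 1) + \<nu>, 1:] ^ n)
                      * pcompose p (\<Prod>\<nu>\<in>GG h. [:\<beta> / (\<alpha> - 1) + \<nu>, 1:] ^ l) | p. True}))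
    \<and> (\<forall>c. phi h (smult c (pderiv h)) \<in> AutCenter h)"
proof -
  have all: "Aut h = range (phi h) \<longrightarrow> DZ h = UNIV \<and> AutCenter h = Aut h"
    using DZ_UNIV[OF _ assms] AutCenter_eq[OF assms] by simp
  have deriv: "\<forall>c. phi h (smult c (pderiv h)) \<in> AutCenter h"
    using AutCenter_eq[OF assms] pderiv_in_DZ[OF assms] by blast
  show ?thesis
    apply (rule conjI[OF AutCenter_eq[OF assms]], rule conjI[OF all],
        rule conjI[OF impI[OF DZ_translations[OF assms]]], assumption, rule conjI[OF _ conjI[OF _ deriv]])
    subgoal by (intro allI impI, elim conjE, rule DZ_linear_power)
    subgoal by (intro allI impI, elim conjE, rule DZ_semidirect[OF assms])
    done
qed

end
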